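(* Let $p>2$ and let $n$ be the dimension. There is a constant $C=C(p,n)$ such that the following holds. Let $\Omega\subset\mathbb{R}^n$ be a bounded domain, let $\varepsilon>0$, and let $u_\varepsilon$ be a positive $p$-harmonious function in $\Omega$ (with step size $\varepsilon$). Assume that $B_{10r}(z_0)\subset\Omega$ and $r>\varepsilon$. Then $$|u_\varepsilon(x)-u_\varepsilon(y)|\le C\,r^{-1}\,|x-y|\,\Big(\sup_{B_{6r}(z_0)}u_\varepsilon-\inf_{B_{6r}(z_0)}u_\varepsilon\Big)$$ for all $x,y\in B_r(z_0)$ with $|x-y|\ge\varepsilon$.
   Context: $B_\rho(x)$ denotes the open ball of radius $\rho$ centered at $x$ in $\mathbb{R}^n$. Fix $p>2$ and set $\alpha=\frac{p-2}{n+p}$, $\beta=\frac{n+2}{n+p}$, so $\alpha+\beta=1$. For a bounded domain $\Omega\subset\mathbb{R}^n$ and $\varepsilon>0$ let $\Gamma_\varepsilon=\{x\in\mathbb{R}^n\setminus\Omega:\operatorname{dist}(x,\partial\Omega)\le\varepsilon\}$ and $\Omega_\varepsilon=\Omega\cup\Gamma_\varepsilon$. A $p$-harmonious function in $\Omega$ (with step size $\varepsilon$) is a bounded Borel measurable function $u_\varepsilon:\Omega_\varepsilon\to\mathbb{R}$ satisfying the dynamic programming principle $$u_\varepsilon(x)=\frac{\alpha}{2}\Big\{\inf_{B_\varepsilon(x)}u_\varepsilon+\sup_{B_\varepsilon(x)}u_\varepsilon\Big\}+\frac{\beta}{|B_\varepsilon(x)|}\int_{B_\varepsilon(x)}u_\varepsilon\,dy\qquad\text{for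 all }x\in\Omega.$$ (Equivalently, it is the value of the tug-of-war with noise game with payoff $F=u_\varepsilon|_{\Gamma_\varepsilon}$.) It is called positive if $u_\varepsilon>0$. *)

theory Defs
  imports "HOL-Analysis.Analysis"
begin

definition bounded_domain :: "(real ^ 'n) set \<Rightarrow> bool" where
  "bounded_domain \<Omega> \<longleftrightarrow> open \<Omega> \<and> connected \<Omega> \<and> \<Omega> \<noteq> {} \<and> bounded \<Omega>"

definition tug_alpha :: "nat \<Rightarrow> real \<Rightarrow> real" where
  "tug_alpha n p = (p - 2) / (real n + p)"

definition tug_beta :: "nat \<Rightarrow> real \<Rightarrow> real" where
  "tug_beta n p = (real n + 2) / (real n + p)"

definition boundary_strip :: "(real ^ 'n) set \<Rightarrow> real \<Rightarrow> (real ^ 'n) set" where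
  "boundary_strip \<Omega> \<epsilon> = {x. x \<notin> \<Omega> \<and> infdist x (frontier \<Omega>) \<le> \<epsilon>}"

definition extended_domain :: "(real ^ 'n) set \<Rightarrow> real \<Rightarrow> (real ^ 'n) set" where
  "extended_domain \<Omega> \<epsilon> = \<Omega> \<union> boundary_strip \<Omega> \<epsilon>"

text \<open>
  A function on the extended domain is a total function whose values elsewhere are irrelevant:
  for \<open>x \<in> \<Omega>\<close> the ball \<open>ball x \<epsilon>\<close> is contained in \<open>extended_domain \<Omega> \<epsilon>\<close>.
\<close>

definition p_harmonious ::
  "real \<Rightarrow> real \<Rightarrow> (real ^ 'n) set \<Rightarrow> (real ^ 'n \<Rightarrow> real) \<Rightarrow> bool" where
  "p_harmonious p \<epsilon> \<Omega> u \<longleftrightarrow>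
     bounded (u ` extended_domain \<Omega> \<epsilon>) \<and>
     u \<in> borel_measurable (restrict_space borel (extended_domain \<Omega> \<epsilon>)) \<and>
     (\<forall>x\<in>\<Omega>. u x =
        tug_alpha CARD('n) p / 2 * ((INF y\<in>ball x \<epsilon>. u y) + (SUP y\<in>ball x \<epsilon>. u y))
        + tug_beta CARD('n) p / measure lborel (ball x \<epsilon>) * (LINT y:ball x \<epsilon>|lborel. u y))"

end

theory Submission
  imports Defs
begin

text \<open>
  The proof bounds the oscillation of \<open>u\<close> over a ball whose centre and radius are played as a game,
  an analytic form of the strategy in which one player of the tug-of-war cancels the moves of the
  other. Let \<open>osc c l\<close> be the supremum of \<open>u x - u y\<close> over \<open>x\<close>, \<open>y\<close> in \<open>ball c (l * \<epsilon>)\<close>, with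
  \<open>osc c 0 = 0\<close>. If \<open>x\<close> moves to a near-supremum and \<open>y\<close> to a near-infimum, both stay in the ball
  of level \<open>l + 1\<close>. In the opposite case both points may be made to step towards \<open>c\<close>, into the ball
  of level \<open>l - 1\<close>. The random displacement is taken to be the same for both points, so
  it only moves the centre. The dynamic programming principle therefore gives
  (\<open>dpp_difference_le\<close>)
  \<open>osc c l \<le> \<alpha>/2 * (osc c (l + 1) + osc c (l - 1)) + \<beta> * (average of osc (c + h) l over h)\<close>.

  Here \<open>l\<close> performs a symmetric random walk stopped at \<open>0\<close>, independent of the direction of the
  moves, and \<open>c\<close> a random walk with centred increments. Starting from the midpoint of \<open>x\<close>, \<open>y\<close> and
  \<open>l\<close> comparable to \<open>dist x y / \<epsilon>\<close>, the probability that \<open>l\<close> reaches \<open>r / \<epsilon>\<close> or \<open>c\<close> travels a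
  distance \<open>2 * r\<close> before \<open>l\<close> reaches \<open>0\<close> is at most a constant times \<open>dist x y / r\<close>. This
  is expressed without probability by an explicit supersolution, the \<open>barrier\<close>
  \<open>(|c - c0| / (2 * r))\<^sup>2 + \<kappa> * (4 * s - s\<^sup>2)\<close> with \<open>s = l * \<epsilon> / r\<close>: it is at least \<open>1\<close> where the game has
  escaped, the concavity in \<open>s\<close> pays for the variance of \<open>c\<close>, and at \<open>c = c0\<close> it is at most
  a multiple of \<open>s\<close>. The comparison (\<open>oscillation_le_barrier\<close>) needs \<open>\<alpha> > 0\<close>, that is \<open>p > 2\<close>,
  since \<open>\<kappa> = 1 / \<alpha>\<close>.
\<close>

section \<open>Averages over balls\<close>

lemma set_integral_ball_translate:
  fixes f :: "'a::euclidean_space \<Rightarrow> real"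
  assumes "set_integrable lborel (ball x e) f"
  shows "set_integrable lborel (ball 0 e) (\<lambda>h. f (x + h))"
    and "(LINT h:ball 0 e|lborel. f (x + h)) = (LINT y:ball x e|lborel. f y)"
proof -
  let ?g = "\<lambda>y. indicator (ball x e) y *\<^sub>R f y"
  have shift: "?g (x + h) = indicator (ball 0 e) h *\<^sub>R f (x + h)" for h
    by (simp add: indicator_def dist_norm)
  have g: "integrable lborel ?g"
    using assms by (simp add: set_integrable_def)
  have "integrable (distr lborel borel ((+) x)) ?g"
    using g by (simp add: lborel_distr_plus)
  then have "integrable lborel (\<lambda>h. ?g (x + h))"
    by (subst (asm) integrable_distr_eq) (use g in auto)
  then show "set_integrable lborel (ball 0 e) (\<lambda>h. f (x + h))"
    unfolding set_integrable_def shift .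
  have "(LINT y|lborel. ?g y) = (LINT y|distr lborel borel ((+) x). ?g y)"
    by (simp add: lborel_distr_plus)
  also have "\<dots> = (LINT h|lborel. ?g (x + h))"
    by (rule integral_distr) (use g in auto)
  finally show "(LINT h:ball 0 e|lborel. f (x + h)) = (LINT y:ball x e|lborel. f y)"
    unfolding set_lebesgue_integral_def shift by simp
qed

lemma set_integrable_ball_continuous:
  fixes f :: "'a::euclidean_space \<Rightarrow> real"
  assumes "continuous_on UNIV f"
  shows "set_integrable lborel (ball x e) f"
proof (rule set_integrable_subset)
  show "set_integrable lborel (cball x e) f"
    unfolding set_integrable_def
    by (rule borel_integrable_compact) (use assms continuous_on_subset in auto)
qed auto

lemma set_integral_ball_inner_eq_0:
  fixes v :: "'a::euclidean_space"
  shows "(LINT h:ball 0 e|lborel. v \<bullet> h) = 0"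
proof -
  let ?g = "\<lambda>h. indicator (ball 0 e) h *\<^sub>R (v \<bullet> h)"
  have "lborel = distr lborel borel (uminus :: 'a \<Rightarrow> 'a)"
    using lborel_affine[of "-1" "0::'a"] by (simp add: density_1)
  then have "(LINT h|lborel. ?g h) = (LINT h|distr lborel borel uminus. ?g h)"
    by simp
  also have "\<dots> = (LINT h|lborel. ?g (- h))"
  proof (rule integral_distr)
    show "?g \<in> borel_measurable borel"
      by (intro borel_measurable_scaleR borel_measurable_indicator borel_measurable_continuous_onI
          continuous_intros) auto
  qed auto
  also have "\<dots> = (LINT h|lborel. - ?g h)"
    by (intro Bochner_Integration.integral_cong) (auto simp: indicator_def)
  also have "\<dots> = - (LINT h|lborel. ?g h)"
    by simp
  finally show ?thesis
    unfolding set_lebesgue_integral_def by simp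
qed

text \<open>
  The mixed term \<open>2 * (v \<bullet> h)\<close> averages to zero by symmetry, so a uniform step of length
  less than \<open>e\<close> raises the expected squared norm by at most \<open>e\<^sup>2\<close>.
\<close>

lemma set_integral_ball_norm_square_le:
  fixes v :: "'a::euclidean_space"
  shows "(LINT h:ball 0 e|lborel. (norm (v + h))\<^sup>2) \<le> ((norm v)\<^sup>2 + e\<^sup>2) * measure lborel (ball (0::'a) e)"
proof -
  have int: "set_integrable lborel (ball 0 e) (\<lambda>h::'a. 2 * (v \<bullet> h))"
            "set_integrable lborel (ball 0 e) (\<lambda>h::'a. (norm v)\<^sup>2 + e\<^sup>2)"
            "set_integrable lborel (ball 0 e) (\<lambda>h. (norm (v + h))\<^sup>2)"
    by (intro set_integrable_ball_continuous continuous_intros)+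
  have "(LINT h:ball 0 e|lborel. (norm (v + h))\<^sup>2)
      \<le> (LINT h:ball 0 e|lborel. ((norm v)\<^sup>2 + e\<^sup>2) + 2 * (v \<bullet> h))"
  proof (rule set_integral_mono)
    show "set_integrable lborel (ball 0 e) (\<lambda>h. ((norm v)\<^sup>2 + e\<^sup>2) + 2 * (v \<bullet> h))"
      by (rule set_integral_add(1)[OF int(2,1)])
    fix h :: 'a assume "h \<in> ball 0 e"
    then have "(norm h)\<^sup>2 \<le> e\<^sup>2"
      by (intro power_mono) auto
    then show "(norm (v + h))\<^sup>2 \<le> ((norm v)\<^sup>2 + e\<^sup>2) + 2 * (v \<bullet> h)"
      by (simp add: power2_norm_eq_inner inner_add inner_commute)
  qed (use int in auto)
  also have "\<dots> = (LINT h:ball (0::'a) e|lborel. (norm v)\<^sup>2 + e\<^sup>2)"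
    unfolding set_integral_add(2)[OF int(2,1)] by (simp add: set_integral_ball_inner_eq_0)
  also have "\<dots> = ((norm v)\<^sup>2 + e\<^sup>2) * measure lborel (ball (0::'a) e)"
    by (simp add: set_lebesgue_integral_def mult.commute)
  finally show ?thesis .
qed

section \<open>One step of the dynamic programming principle for two points\<close>

definition dpp_at :: "real \<Rightarrow> real \<Rightarrow> real \<Rightarrow> ('a::euclidean_space \<Rightarrow> real) \<Rightarrow> 'a \<Rightarrow> bool" where
  "dpp_at \<alpha> \<beta> \<epsilon> u x \<longleftrightarrow>
     u x = \<alpha> / 2 * ((INF y\<in>ball x \<epsilon>. u y) + (SUP y\<in>ball x \<epsilon>. u y))
         + \<beta> / measure lborel (ball x \<epsilon>) * (LINT y:ball x \<epsilon>|lborel. u y)"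

text \<open>
  In \<open>u x - u y\<close> the supremum at \<open>x\<close> is paired with the infimum at \<open>y\<close>, which is controlled
  by all moves of both points, and the infimum at \<open>x\<close> with the supremum at \<open>y\<close>, for which one pair
  of moves \<open>x'\<close>, \<open>y'\<close> of our choice suffices. The averages are coupled by
  giving both points the same random displacement.
\<close>

lemma dpp_difference_le:
  fixes u :: "'a::euclidean_space \<Rightarrow> real"
  assumes dpp: "dpp_at \<alpha> \<beta> \<epsilon> u x" "dpp_at \<alpha> \<beta> \<epsilon> u y"
    and coeffs: "\<alpha> \<ge> 0" "\<beta> \<ge> 0" and eps: "\<epsilon> > 0"
    and bdd: "bdd_above (u ` ball y \<epsilon>)" "bdd_below (u ` ball x \<epsilon>)"
    and int: "set_integrable lborel (ball x \<epsilon>) u" "set_integrable lborel (ball y \<epsilon>) u"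
    and up: "\<And>x' y'. x' \<in> ball x \<epsilon> \<Longrightarrow> y' \<in> ball y \<epsilon> \<Longrightarrow> u x' - u y' \<le> K"
    and down: "x' \<in> ball x \<epsilon>" "y' \<in> ball y \<epsilon>" "u x' - u y' \<le> L"
    and noise: "\<And>h. h \<in> ball 0 \<epsilon> \<Longrightarrow> u (x + h) - u (y + h) \<le> q h"
    and q: "set_integrable lborel (ball 0 \<epsilon>) q"
           "(LINT h:ball 0 \<epsilon>|lborel. q h) \<le> Q * measure lborel (ball (0::'a) \<epsilon>)"
  shows "u x - u y \<le> \<alpha> / 2 * (K + L) + \<beta> * Q"
proof -
  define m where "m = measure lborel (ball (0::'a) \<epsilon>)"
  have ne: "ball x \<epsilon> \<noteq> {}" "ball y \<epsilon> \<noteq> {}"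
    using eps by auto
  have m: "m > 0" "measure lborel (ball x \<epsilon>) = m" "measure lborel (ball y \<epsilon>) = m"
    using eps by (simp_all add: m_def content_ball_pos content_ball)
  have sup_inf: "(SUP z\<in>ball x \<epsilon>. u z) - (INF z\<in>ball y \<epsilon>. u z) \<le> K"
  proof -
    have "(SUP z\<in>ball x \<epsilon>. u z) \<le> K + (INF z\<in>ball y \<epsilon>. u z)"
    proof (rule cSUP_least[OF ne(1)])
      fix a assume a: "a \<in> ball x \<epsilon>"
      have "u a - K \<le> (INF z\<in>ball y \<epsilon>. u z)"
        by (rule cINF_greatest[OF ne(2)]) (use up[OF a] in force)
      then show "u a \<le> K + (INF z\<in>ball y \<epsilon>. u z)" by simp
    qed
    then show ?thesis by simp
  qed
  have inf_sup: "(INF z\<in>ball x \<epsilon>. u z) - (SUP z\<in>ball y \<epsilon>. u z) \<le> L"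
    using cINF_lower[OF bdd(2) down(1)] cSUP_upper[OF down(2) bdd(1)] down(3) by simp
  have avg: "(LINT z:ball x \<epsilon>|lborel. u z) - (LINT z:ball y \<epsilon>|lborel. u z) \<le> Q * m"
  proof -
    note X = set_integral_ball_translate[OF int(1)] and Y = set_integral_ball_translate[OF int(2)]
    have "(LINT z:ball x \<epsilon>|lborel. u z) - (LINT z:ball y \<epsilon>|lborel. u z)
        = (LINT h:ball 0 \<epsilon>|lborel. u (x + h) - u (y + h))"
      using X Y by (simp add: set_integral_diff)
    also have "\<dots> \<le> (LINT h:ball 0 \<epsilon>|lborel. q h)"
      using X Y q noise by (intro set_integral_mono set_integral_diff) auto
    finally show ?thesis using q(2) by (simp add: m_def)
  qed
  have "u x - u y = \<alpha> / 2 * (((SUP z\<in>ball x \<epsilon>. u z) - (INF z\<in>ball y \<epsilon>. u z))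
          + ((INF z\<in>ball x \<epsilon>. u z) - (SUP z\<in>ball y \<epsilon>. u z)))
        + \<beta> * (((LINT z:ball x \<epsilon>|lborel. u z) - (LINT z:ball y \<epsilon>|lborel. u z)) / m)"
    using dpp by (simp add: dpp_at_def m(2,3) algebra_simps add_divide_distrib diff_divide_distrib)
  also have "\<dots> \<le> \<alpha> / 2 * (K + L) + \<beta> * Q"
    using coeffs sup_inf inf_sup avg m(1)
    by (intro add_mono mult_left_mono) (auto simp: divide_le_eq)
  finally show ?thesis .
qed

section \<open>The barrier\<close>

text \<open>
  The vector \<open>v\<close> is the displacement of the centre and \<open>t\<close> the radius of the ball. The
  parabola \<open>4 * s - s\<^sup>2\<close> has its maximum at \<open>s = 2\<close>, beyond all values of \<open>s\<close> that occur: the game stops once \<open>s \<ge> 1\<close>, and a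
  step raises \<open>s\<close> by \<open>\<epsilon> / r < 1\<close>.
\<close>

definition barrier :: "real \<Rightarrow> real \<Rightarrow> 'a::real_normed_vector \<Rightarrow> real \<Rightarrow> real" where
  "barrier \<kappa> r v t = (norm v / (2 * r))\<^sup>2 + \<kappa> * (4 * (t / r) - (t / r)\<^sup>2)"

lemma barrier_nonneg:
  assumes "\<kappa> \<ge> 0" "r > 0" "0 \<le> t" "t \<le> 2 * r"
  shows "barrier \<kappa> r v t \<ge> 0"
proof -
  have "0 \<le> t / r" "t / r \<le> 2"
    using assms by (auto simp: divide_le_eq)
  then have "\<kappa> * ((t / r) * (4 - t / r)) \<ge> 0"
    using assms by (intro mult_nonneg_nonneg) auto
  also have "(t / r) * (4 - t / r) = 4 * (t / r) - (t / r)\<^sup>2"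
    by (simp add: algebra_simps power2_eq_square)
  finally show ?thesis
    unfolding barrier_def by (intro add_nonneg_nonneg) simp_all
qed

text \<open>The exit condition of the game: the centre has travelled far or the ball has become large.\<close>

lemma barrier_ge_1:
  assumes "\<kappa> \<ge> 1" "r > 0" "0 \<le> t" "t \<le> 2 * r" and far: "norm v \<ge> 2 * r \<or> t \<ge> r"
  shows "barrier \<kappa> r v t \<ge> 1"
proof -
  define s where "s = t / r"
  have s: "0 \<le> s" "s \<le> 2"
    using assms by (auto simp: s_def divide_le_eq)
  have s0: "4 * s - s\<^sup>2 = s * (4 - s)"
    by (simp add: algebra_simps power2_eq_square)
  have s1: "4 * s - s\<^sup>2 \<ge> 0"
    unfolding s0 using s by (intro mult_nonneg_nonneg) auto
  show ?thesis
  proof (cases "t \<ge> r")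
    case True
    then have "s \<ge> 1" using assms by (simp add: s_def le_divide_eq)
    then have "1 * 1 \<le> s * (4 - s)"
      using s by (intro mult_mono) auto
    then have "1 * 1 \<le> \<kappa> * (4 * s - s\<^sup>2)"
      using assms unfolding s0 by (intro mult_mono) auto
    moreover have "0 \<le> (norm v / (2 * r))\<^sup>2"
      by simp
    ultimately show ?thesis
      unfolding barrier_def s_def by linarith
  next
    case False
    then have "1 \<le> norm v / (2 * r)"
      using assms by (simp add: le_divide_eq)
    then have "1 \<le> (norm v / (2 * r))\<^sup>2"
      by (rule one_le_power)
    moreover have "0 \<le> \<kappa> * (4 * s - s\<^sup>2)"
      using assms s1 by (intro mult_nonneg_nonneg) auto
    ultimately show ?thesis
      unfolding barrier_def s_def by linarith
  qed
qed

text \<open>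
  The two tug-of-war outcomes \<open>t + e\<close> and \<open>t - e\<close> lower the barrier by \<open>\<kappa> * (e / r)\<^sup>2\<close> on average,
  exactly because it is quadratic in \<open>t\<close>. This gain is to be compared with the loss
  \<open>(e / r)\<^sup>2 / 4\<close> that the random displacement of the centre causes in the lemma after this one.
\<close>

lemma barrier_second_difference:
  "barrier \<kappa> r v (t + e) + barrier \<kappa> r v (t - e) = 2 * barrier \<kappa> r v t - 2 * \<kappa> * (e / r)\<^sup>2"
  by (simp add: barrier_def power2_eq_square add_divide_distrib diff_divide_distrib algebra_simps)

text \<open>
  The affine form \<open>W * barrier + M\<close> is the one used in the comparison: \<open>W\<close> is the total
  oscillation and \<open>M\<close> the excess not yet removed.
\<close>

lemma barrier_set_integral_le:
  fixes v :: "'a::euclidean_space"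
  assumes "W \<ge> 0"
  shows "set_integrable lborel (ball 0 e) (\<lambda>h. W * barrier \<kappa> r (v + h) t + M)"
    and "(LINT h:ball 0 e|lborel. W * barrier \<kappa> r (v + h) t + M)
      \<le> (W * (barrier \<kappa> r v t + (e / r)\<^sup>2 / 4) + M) * measure lborel (ball (0::'a) e)"
proof -
  define a where "a = W / (2 * r)\<^sup>2"
  define b where "b = W * (\<kappa> * (4 * (t / r) - (t / r)\<^sup>2)) + M"
  have eq: "W * barrier \<kappa> r w t + M = a * (norm w)\<^sup>2 + b" for w :: 'a
    by (simp add: barrier_def a_def b_def power_divide algebra_simps)
  have int: "set_integrable lborel (ball 0 e) (\<lambda>h. a * (norm (v + h))\<^sup>2)"
            "set_integrable lborel (ball 0 e) (\<lambda>h::'a. b)"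
    by (intro set_integrable_ball_continuous continuous_intros)+
  then show "set_integrable lborel (ball 0 e) (\<lambda>h. W * barrier \<kappa> r (v + h) t + M)"
    unfolding eq by (intro set_integral_add)
  have "(LINT h:ball 0 e|lborel. W * barrier \<kappa> r (v + h) t + M)
      = a * (LINT h:ball 0 e|lborel. (norm (v + h))\<^sup>2) + b * measure lborel (ball (0::'a) e)"
    unfolding eq using int by (simp add: set_integral_add) (simp add: set_lebesgue_integral_def)
  also have "\<dots> \<le> a * (((norm v)\<^sup>2 + e\<^sup>2) * measure lborel (ball (0::'a) e)) + b * measure lborel (ball (0::'a) e)"
    using assms by (intro add_right_mono mult_left_mono set_integral_ball_norm_square_le) (simp add: a_def)
  also have "\<dots> = ((a * (norm v)\<^sup>2 + b) + a * e\<^sup>2) * measure lborel (ball (0::'a) e)"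
    by (simp add: algebra_simps)
  also have "\<dots> = (W * (barrier \<kappa> r v t + (e / r)\<^sup>2 / 4) + M) * measure lborel (ball (0::'a) e)"
    unfolding eq[symmetric] by (simp add: a_def power_divide algebra_simps)
  finally show "(LINT h:ball 0 e|lborel. W * barrier \<kappa> r (v + h) t + M)
      \<le> (W * (barrier \<kappa> r v t + (e / r)\<^sup>2 / 4) + M) * measure lborel (ball (0::'a) e)" .
qed

section \<open>Comparison of the oscillation with the barrier\<close>

text \<open>
  The cancelling move: scaling towards \<open>c\<close> by \<open>1 - 1/l\<close> costs less than \<open>\<epsilon>\<close> and lands in the ball of the
  next lower level. At level \<open>1\<close> it lands on \<open>c\<close> itself, which is kept as a separate conclusion
  because the open ball of level \<open>0\<close> is empty.
\<close>

lemma ball_scale_towards_center: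
  fixes x c :: "'a::real_normed_vector"
  assumes "x \<in> ball c (real l * \<epsilon>)" "l \<ge> 1"
  obtains x' where "x' \<in> ball x \<epsilon>" "l = 1 \<Longrightarrow> x' = c"
    "l > 1 \<Longrightarrow> x' \<in> ball c (real (l - 1) * \<epsilon>)"
proof
  let ?x' = "x - (1 / real l) *\<^sub>R (x - c)"
  have l: "real l > 0" using assms by simp
  have d: "norm (x - c) < real l * \<epsilon>"
    using assms by (simp add: dist_norm norm_minus_commute)
  have "dist x ?x' = norm (x - c) / real l"
    by (simp add: dist_norm)
  then show "?x' \<in> ball x \<epsilon>"
    using d l by (simp add: divide_less_eq mult.commute)
  show "?x' = c" if "l = 1"
    using that by simp
  show "?x' \<in> ball c (real (l - 1) * \<epsilon>)" if "l > 1"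
  proof -
    have "?x' - c = (real (l - 1) / real l) *\<^sub>R (x - c)"
      using l that by (simp add: of_nat_diff diff_divide_distrib scaleR_left_diff_distrib)
    then have "norm (?x' - c) = (real (l - 1) / real l) * norm (x - c)"
      by simp
    also have "\<dots> < (real (l - 1) / real l) * (real l * \<epsilon>)"
      using d l that by (intro mult_strict_left_mono) auto
    also have "\<dots> = real (l - 1) * \<epsilon>"
      using l by simp
    finally show ?thesis
      by (simp add: dist_norm norm_minus_commute)
  qed
qed

text \<open>
  Each application of the dynamic programming principle lowers the excess over the barrier by a
  fixed amount. With \<open>\<kappa> = 1 / \<alpha>\<close> the tug-of-war part gains \<open>W * (\<epsilon> / r)\<^sup>2\<close> and the noise loses
  \<open>\<beta> / 4\<close> of it, so at least half is left. Induction on the number \<open>k\<close> of applications avoids the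
  question whether the oscillation over a moving ball is measurable as a function of the centre:
  only \<open>u\<close> and the barrier are ever integrated.
\<close>

lemma oscillation_le_barrier_plus_excess:
  fixes u :: "'a::euclidean_space \<Rightarrow> real"
  assumes coeffs: "\<alpha> > 0" "\<beta> \<ge> 0" "\<alpha> + \<beta> = 1" and eps: "\<epsilon> > 0" "\<epsilon> < r"
    and dpp: "\<And>x. x \<in> ball z0 (4 * r) \<Longrightarrow> dpp_at \<alpha> \<beta> \<epsilon> u x"
    and int: "\<And>x. x \<in> ball z0 (4 * r) \<Longrightarrow> set_integrable lborel (ball x \<epsilon>) u"
    and bdd: "bdd_above (u ` ball z0 (6 * r))" "bdd_below (u ` ball z0 (6 * r))"
    and W: "W \<ge> 0" "\<And>x y. x \<in> ball z0 (6 * r) \<Longrightarrow> y \<in> ball z0 (6 * r) \<Longrightarrow> u x - u y \<le> W"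
    and c0: "c0 \<in> ball z0 r"
    and c: "c \<in> ball c0 (2 * r)" and l: "l \<ge> 1" "real l * \<epsilon> < r"
    and xy: "x \<in> ball c (real l * \<epsilon>)" "y \<in> ball c (real l * \<epsilon>)"
  shows "u x - u y \<le> W * barrier (1 / \<alpha>) r (c - c0) (real l * \<epsilon>)
           + max 0 (W - real k * (W * (\<epsilon> / r)\<^sup>2 / 2))"
  using c l xy
proof (induction k arbitrary: c l x y)
  case 0
  have "0 \<le> barrier (1 / \<alpha>) r (c - c0) (real l * \<epsilon>)"
    using coeffs eps 0 by (intro barrier_nonneg) auto
  moreover have "x \<in> ball z0 (6 * r)" "y \<in> ball z0 (6 * r)"
    using c0 0 eps dist_triangle[of z0 x c] dist_triangle[of z0 y c] dist_triangle[of z0 c c0]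
    by (auto simp: dist_commute)
  then have "u x - u y \<le> W" by (rule W)
  ultimately show ?case
    using W(1) by (simp add: add_increasing)
next
  case (Suc k)
  define M where "M = max 0 (W - real k * (W * (\<epsilon> / r)\<^sup>2 / 2))"
  let ?b = "barrier (1 / \<alpha>) r"
  have M0: "M \<ge> 0" by (simp add: M_def)
  have \<alpha>1: "1 / \<alpha> \<ge> 1" using coeffs by simp
  have r: "r > 0" using eps by simp
  have in6: "x \<in> ball z0 (6 * r)" if "c \<in> ball c0 (3 * r)" "x \<in> ball c (real l * \<epsilon>)" "real l * \<epsilon> < 2 * r"
    for c x l
    using c0 that dist_triangle[of z0 x c] dist_triangle[of z0 c c0] by (auto simp: dist_commute)
  \<comment> \<open>One step from the region \<open>c \<in> ball c0 (2 * r)\<close>, \<open>l * \<epsilon> < r\<close> may leave it, but by less than \<open>r\<close>.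
      Outside that region the barrier exceeds \<open>1\<close> and the trivial bound \<open>W\<close> suffices.\<close>
  have next_le: "u x - u y \<le> W * ?b (c - c0) (real l * \<epsilon>) + M"
    if "c \<in> ball c0 (3 * r)" "l \<ge> 1" "real l * \<epsilon> < 2 * r"
      "x \<in> ball c (real l * \<epsilon>)" "y \<in> ball c (real l * \<epsilon>)" for c x y l
  proof (cases "c \<in> ball c0 (2 * r) \<and> real l * \<epsilon> < r")
    case True
    then show ?thesis
      using Suc.IH[of c l x y] that by (simp add: M_def)
  next
    case False
    then have "1 \<le> ?b (c - c0) (real l * \<epsilon>)"
      using that eps r \<alpha>1 by (intro barrier_ge_1) (auto simp: dist_norm norm_minus_commute)
    then have "W * 1 \<le> W * ?b (c - c0) (real l * \<epsilon>)"
      using W(1) by (intro mult_left_mono)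
    moreover have "u x - u y \<le> W"
      using that in6 by (intro W(2)) blast+
    ultimately show ?thesis using M0 by simp
  qed
  have cx: "dist c0 c < 2 * r" "dist c x < real l * \<epsilon>" "dist c y < real l * \<epsilon>" "real l * \<epsilon> < r"
    using Suc.prems by auto
  have in4: "x \<in> ball z0 (4 * r)" "y \<in> ball z0 (4 * r)"
    using c0 cx dist_triangle[of z0 x c] dist_triangle[of z0 y c] dist_triangle[of z0 c c0]
    by (auto simp: dist_commute)
  have sub: "ball x \<epsilon> \<subseteq> ball z0 (6 * r)" "ball y \<epsilon> \<subseteq> ball z0 (6 * r)"
    using in4 eps by (auto simp: ball_subset_ball_iff dist_commute)
  obtain x' where x': "x' \<in> ball x \<epsilon>" "l = 1 \<Longrightarrow> x' = c" "l > 1 \<Longrightarrow> x' \<in> ball c (real (l - 1) * \<epsilon>)"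
    using ball_scale_towards_center Suc.prems(2,4) by metis
  obtain y' where y': "y' \<in> ball y \<epsilon>" "l = 1 \<Longrightarrow> y' = c" "l > 1 \<Longrightarrow> y' \<in> ball c (real (l - 1) * \<epsilon>)"
    using ball_scale_towards_center Suc.prems(2,5) by metis
  have t: "real (l + 1) * \<epsilon> = real l * \<epsilon> + \<epsilon>" "real (l - 1) * \<epsilon> = real l * \<epsilon> - \<epsilon>"
    using Suc.prems(2) by (auto simp: algebra_simps of_nat_diff)
  have "u x - u y \<le> \<alpha> / 2 * ((W * ?b (c - c0) (real l * \<epsilon> + \<epsilon>) + M) + (W * ?b (c - c0) (real l * \<epsilon> - \<epsilon>) + M))
      + \<beta> * (W * (?b (c - c0) (real l * \<epsilon>) + (\<epsilon> / r)\<^sup>2 / 4) + M)"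
  proof (rule dpp_difference_le[where q = "\<lambda>h. W * ?b ((c - c0) + h) (real l * \<epsilon>) + M"])
    show "dpp_at \<alpha> \<beta> \<epsilon> u x" "dpp_at \<alpha> \<beta> \<epsilon> u y"
      using dpp in4 by auto
    show "set_integrable lborel (ball x \<epsilon>) u" "set_integrable lborel (ball y \<epsilon>) u"
      using int in4 by auto
    show "bdd_above (u ` ball y \<epsilon>)" "bdd_below (u ` ball x \<epsilon>)"
      using bdd sub by (meson bdd_above_mono bdd_below_mono image_mono)+
    show "u a - u b \<le> W * ?b (c - c0) (real l * \<epsilon> + \<epsilon>) + M"
      if "a \<in> ball x \<epsilon>" "b \<in> ball y \<epsilon>" for a b
    proof -
      have "a \<in> ball c (real (l + 1) * \<epsilon>)" "b \<in> ball c (real (l + 1) * \<epsilon>)"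
        unfolding t using that cx dist_triangle[of c a x] dist_triangle[of c b y] by auto
      then have "u a - u b \<le> W * ?b (c - c0) (real (l + 1) * \<epsilon>) + M"
        using cx eps r t by (intro next_le) auto
      then show ?thesis unfolding t .
    qed
    show "x' \<in> ball x \<epsilon>" "y' \<in> ball y \<epsilon>" by fact+
    show "u x' - u y' \<le> W * ?b (c - c0) (real l * \<epsilon> - \<epsilon>) + M"
    proof (cases "l = 1")
      case True
      have "0 \<le> ?b (c - c0) 0"
        using coeffs r by (intro barrier_nonneg) auto
      then show ?thesis
        using True x' y' W(1) M0 by simp
    next
      case False
      then have "l > 1" using Suc.prems by simp
      then have "u x' - u y' \<le> W * ?b (c - c0) (real (l - 1) * \<epsilon>) + M"
        using cx eps r t x' y' by (intro next_le) auto
      then show ?thesis unfolding t .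
    qed
    show "u (x + h) - u (y + h) \<le> W * ?b ((c - c0) + h) (real l * \<epsilon>) + M"
      if "h \<in> ball 0 \<epsilon>" for h
    proof -
      have "dist c0 (c + h) \<le> dist c0 c + norm h"
        using dist_triangle[of c0 "c + h" c] by (simp add: dist_norm)
      then have "u (x + h) - u (y + h) \<le> W * ?b ((c + h) - c0) (real l * \<epsilon>) + M"
        using that cx eps Suc.prems r by (intro next_le) auto
      then show ?thesis by (simp add: algebra_simps)
    qed
  qed (use coeffs eps barrier_set_integral_le[OF W(1)] in auto)
  also have "\<dots> = (\<alpha> + \<beta>) * (W * ?b (c - c0) (real l * \<epsilon>) + M) - W * (\<epsilon> / r)\<^sup>2 * (1 - \<beta> / 4)"
  proof -
    have "\<alpha> / 2 * ((W * ?b (c - c0) (real l * \<epsilon> + \<epsilon>) + M) + (W * ?b (c - c0) (real l * \<epsilon> - \<epsilon>) + M))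
        = \<alpha> / 2 * (W * (?b (c - c0) (real l * \<epsilon> + \<epsilon>) + ?b (c - c0) (real l * \<epsilon> - \<epsilon>)) + 2 * M)"
      by (simp add: algebra_simps)
    also have "\<dots> = \<alpha> * (W * ?b (c - c0) (real l * \<epsilon>) + M) - W * (\<epsilon> / r)\<^sup>2"
      unfolding barrier_second_difference using coeffs(1) by (simp add: field_simps)
    finally show ?thesis by (simp add: algebra_simps)
  qed
  also have "\<dots> \<le> W * ?b (c - c0) (real l * \<epsilon>) + M - W * (\<epsilon> / r)\<^sup>2 * (1 / 2)"
    unfolding coeffs(3) mult_1 using coeffs W(1)
    by (intro diff_left_mono mult_left_mono) auto
  also have "\<dots> \<le> W * ?b (c - c0) (real l * \<epsilon>) + max 0 (W - real (Suc k) * (W * (\<epsilon> / r)\<^sup>2 / 2))"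
  proof -
    have "W * (\<epsilon> / r)\<^sup>2 / 2 \<ge> 0" using W(1) by simp
    then show ?thesis by (auto simp: M_def max_def algebra_simps)
  qed
  finally show ?case .
qed

lemma oscillation_le_barrier:
  fixes u :: "'a::euclidean_space \<Rightarrow> real"
  assumes coeffs: "\<alpha> > 0" "\<beta> \<ge> 0" "\<alpha> + \<beta> = 1" and eps: "\<epsilon> > 0" "\<epsilon> < r"
    and dpp: "\<And>x. x \<in> ball z0 (4 * r) \<Longrightarrow> dpp_at \<alpha> \<beta> \<epsilon> u x"
    and int: "\<And>x. x \<in> ball z0 (4 * r) \<Longrightarrow> set_integrable lborel (ball x \<epsilon>) u"
    and bdd: "bdd_above (u ` ball z0 (6 * r))" "bdd_below (u ` ball z0 (6 * r))"
    and W: "W \<ge> 0" "\<And>x y. x \<in> ball z0 (6 * r) \<Longrightarrow> y \<in> ball z0 (6 * r) \<Longrightarrow> u x - u y \<le> W"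
    and c: "c \<in> ball z0 r" and l: "l \<ge> 1" "real l * \<epsilon> < r"
    and xy: "x \<in> ball c (real l * \<epsilon>)" "y \<in> ball c (real l * \<epsilon>)"
  shows "u x - u y \<le> W * barrier (1 / \<alpha>) r (0::'a) (real l * \<epsilon>)"
proof -
  define d where "d = (\<epsilon> / r)\<^sup>2 / 2"
  have "d > 0" using eps by (simp add: d_def)
  then obtain k where k: "real k * d > 1"
    using reals_Archimedean3 by blast
  have "W * 1 \<le> W * (real k * d)"
    using k W(1) by (intro mult_left_mono) auto
  then have "max 0 (W - real k * (W * (\<epsilon> / r)\<^sup>2 / 2)) = 0"
    by (simp add: d_def algebra_simps)
  moreover have "c \<in> ball c (2 * r)" using eps by simp
  note oscillation_le_barrier_plus_excess[OF coeffs eps dpp int bdd W c this l xy, of k]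
  ultimately show ?thesis by simp
qed

text \<open>
  The level \<open>l\<close> is the least for which \<open>x\<close> and \<open>y\<close> lie in the open ball around their midpoint. Rounding
  up adds at most \<open>\<epsilon> \<le> dist x y\<close> to the radius \<open>dist x y / 2\<close>, which is where the lower bound on the
  distance enters: the radius is at most \<open>3/2 * dist x y\<close>, and the slope \<open>4 / \<alpha>\<close> of the barrier turns this
  into the factor \<open>6 / \<alpha>\<close>. If that radius is already at least \<open>r\<close>, the
  estimate is weaker than the bound by the full oscillation.
\<close>

lemma dpp_lipschitz_estimate:
  fixes u :: "'a::euclidean_space \<Rightarrow> real"
  assumes coeffs: "\<alpha> > 0" "\<beta> \<ge> 0" "\<alpha> + \<beta> = 1" and eps: "\<epsilon> > 0" "\<epsilon> < r"
    and dpp: "\<And>x. x \<in> ball z0 (4 * r) \<Longrightarrow> dpp_at \<alpha> \<beta> \<epsilon> u x"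
    and int: "\<And>x. x \<in> ball z0 (4 * r) \<Longrightarrow> set_integrable lborel (ball x \<epsilon>) u"
    and bdd: "bdd_above (u ` ball z0 (6 * r))" "bdd_below (u ` ball z0 (6 * r))"
    and xy: "x \<in> ball z0 r" "y \<in> ball z0 r" "dist x y \<ge> \<epsilon>"
  shows "u x - u y \<le> 6 / \<alpha> * inverse r * dist x y *
           ((SUP z\<in>ball z0 (6 * r). u z) - (INF z\<in>ball z0 (6 * r). u z))"
proof -
  define W where "W = (SUP z\<in>ball z0 (6 * r). u z) - (INF z\<in>ball z0 (6 * r). u z)"
  define c where "c = midpoint x y"
  define l where "l = nat \<lfloor>dist x y / (2 * \<epsilon>)\<rfloor> + 1"
  have r: "r > 0" using eps by simp
  have \<alpha>: "\<alpha> \<le> 1" using coeffs by simp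
  have W_bound: "u a - u b \<le> W" if "a \<in> ball z0 (6 * r)" "b \<in> ball z0 (6 * r)" for a b
    using cSUP_upper[OF that(1) bdd(1)] cINF_lower[OF bdd(2) that(2)] by (simp add: W_def)
  have in6: "x \<in> ball z0 (6 * r)" "y \<in> ball z0 (6 * r)"
    using xy r by auto
  have W0: "W \<ge> 0" using W_bound[OF in6(1) in6(1)] by simp
  have c: "c \<in> ball z0 r"
    using xy convex_ball[of z0 r] by (auto simp: c_def midpoint_def convex_def scaleR_add_right)
  have l_eq: "real l = real_of_int \<lfloor>dist x y / (2 * \<epsilon>)\<rfloor> + 1"
    using eps by (simp add: l_def)
  then have "dist x y / (2 * \<epsilon>) < real l" "real l \<le> dist x y / (2 * \<epsilon>) + 1"
    by linarith+
  then have l: "dist x y / 2 < real l * \<epsilon>" "real l * \<epsilon> \<le> dist x y / 2 + \<epsilon>"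
    using eps by (simp_all add: field_simps)
  show ?thesis
  proof (cases "real l * \<epsilon> < r")
    case True
    have "u x - u y \<le> W * barrier (1 / \<alpha>) r (0::'a) (real l * \<epsilon>)"
    proof (rule oscillation_le_barrier[OF coeffs eps dpp int bdd W0 W_bound c _ True])
      show "x \<in> ball c (real l * \<epsilon>)" "y \<in> ball c (real l * \<epsilon>)"
        using l by (auto simp: c_def dist_midpoint)
    qed (simp_all add: l_def)
    also have "\<dots> \<le> W * (6 / \<alpha> * inverse r * dist x y)"
    proof (rule mult_left_mono[OF _ W0])
      have "barrier (1 / \<alpha>) r (0::'a) (real l * \<epsilon>) \<le> 1 / \<alpha> * (4 * (real l * \<epsilon> / r))"
        using coeffs(1) unfolding barrier_def norm_zero
        by (simp del: times_divide_eq_right times_divide_eq_left)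
      also have "\<dots> \<le> 1 / \<alpha> * (6 * (dist x y / r))"
        using l xy(3) coeffs r by (intro mult_left_mono) (auto simp: field_simps)
      finally show "barrier (1 / \<alpha>) r (0::'a) (real l * \<epsilon>) \<le> 6 / \<alpha> * inverse r * dist x y"
        by (simp add: field_simps)
    qed
    finally show ?thesis by (simp add: W_def mult.commute)
  next
    case False
    then have "1 \<le> 6 * (dist x y / r)"
      using l xy(3) r by (simp add: field_simps)
    also have "\<dots> \<le> 1 / \<alpha> * (6 * (dist x y / r))"
      using \<alpha> coeffs r mult_right_mono[of 1 "1 / \<alpha>" "6 * (dist x y / r)"] by simp
    also have "\<dots> = 6 / \<alpha> * inverse r * dist x y"
      by (simp add: field_simps)
    finally have "1 * W \<le> 6 / \<alpha> * inverse r * dist x y * W"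
      using W0 by (intro mult_right_mono)
    then show ?thesis
      using W_bound[OF in6] by (simp add: W_def)
  qed
qed

section \<open>Local Lipschitz estimate for p-harmonious functions\<close>

lemma p_harmonious_set_integrable:
  assumes "p_harmonious p \<epsilon> \<Omega> u" "ball x \<rho> \<subseteq> \<Omega>"
  shows "set_integrable lborel (ball x \<rho>) u"
proof -
  have sub: "ball x \<rho> \<subseteq> extended_domain \<Omega> \<epsilon>"
    using assms(2) by (auto simp: extended_domain_def)
  have "u \<in> borel_measurable (restrict_space borel (ball x \<rho>))"
    using measurable_restrict_mono[OF _ sub] assms(1) by (auto simp: p_harmonious_def)
  then have meas: "(\<lambda>y. indicator (ball x \<rho>) y *\<^sub>R u y) \<in> borel_measurable borel"
    by (subst (asm) borel_measurable_restrict_space_iff) auto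
  obtain B where "\<And>y. y \<in> extended_domain \<Omega> \<epsilon> \<Longrightarrow> norm (u y) \<le> B"
    using assms(1) by (auto simp: p_harmonious_def bounded_iff)
  then have "\<And>y. y \<in> ball x \<rho> \<Longrightarrow> norm (u y) \<le> B"
    using sub by blast
  then show ?thesis
    unfolding set_integrable_def using meas
    by (intro integrableI_bounded_set[where A = "ball x \<rho>" and B = B])
       (use emeasure_lborel_ball_finite[of x \<rho>] in \<open>auto simp: indicator_def\<close>)
qed

theorem theorem3p2:
  fixes p :: real
  assumes "p > 2"
  shows "\<exists>C::real. \<forall>(\<Omega> :: (real ^ 'n) set) (\<epsilon>::real) (u :: real ^ 'n \<Rightarrow> real) (z0 :: real ^ 'n) (r::real).
    bounded_domain \<Omega> \<longrightarrow> \<epsilon> > 0 \<longrightarrow>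
    p_harmonious p \<epsilon> \<Omega> u \<longrightarrow> (\<forall>x\<in>extended_domain \<Omega> \<epsilon>. u x > 0) \<longrightarrow>
    ball z0 (10 * r) \<subseteq> \<Omega> \<longrightarrow> r > \<epsilon> \<longrightarrow>
    (\<forall>x\<in>ball z0 r. \<forall>y\<in>ball z0 r. dist x y \<ge> \<epsilon> \<longrightarrow>
      \<bar>u x - u y\<bar> \<le> C * inverse r * dist x y *
        ((SUP z\<in>ball z0 (6 * r). u z) - (INF z\<in>ball z0 (6 * r). u z)))"
proof -
  define \<alpha> where "\<alpha> = tug_alpha CARD('n) p"
  define \<beta> where "\<beta> = tug_beta CARD('n) p"
  have coeffs: "\<alpha> > 0" "\<beta> \<ge> 0" "\<alpha> + \<beta> = 1"
    using assms by (auto simp: \<alpha>_def \<beta>_def tug_alpha_def tug_beta_def add_divide_distrib[symmetric]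
        intro!: divide_pos_pos)
  show ?thesis
  proof (intro exI[of _ "6 / \<alpha>"] allI impI ballI)
    fix \<Omega> :: "(real ^ 'n) set" and \<epsilon> :: real and u :: "real ^ 'n \<Rightarrow> real" and z0 x y :: "real ^ 'n" and r :: real
    assume eps: "\<epsilon> > 0" "r > \<epsilon>" and u: "p_harmonious p \<epsilon> \<Omega> u" and sub: "ball z0 (10 * r) \<subseteq> \<Omega>"
      and xy: "x \<in> ball z0 r" "y \<in> ball z0 r" "dist x y \<ge> \<epsilon>"
    have "ball z0 (6 * r) \<subseteq> extended_domain \<Omega> \<epsilon>"
      using sub eps by (auto simp: extended_domain_def subset_iff)
    then have "bounded (u ` ball z0 (6 * r))"
      using u by (meson bounded_subset image_mono p_harmonious_def)
    then have bdd: "bdd_above (u ` ball z0 (6 * r))" "bdd_below (u ` ball z0 (6 * r))"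
      by (auto intro: bounded_imp_bdd_above bounded_imp_bdd_below)
    have dpp: "dpp_at \<alpha> \<beta> \<epsilon> u a" if "a \<in> ball z0 (4 * r)" for a
    proof -
      have "a \<in> \<Omega>" using that sub eps by auto
      then show ?thesis
        using u by (simp add: p_harmonious_def dpp_at_def \<alpha>_def \<beta>_def)
    qed
    have int: "set_integrable lborel (ball a \<epsilon>) u" if "a \<in> ball z0 (4 * r)" for a
    proof (rule p_harmonious_set_integrable[OF u])
      have "ball a \<epsilon> \<subseteq> ball z0 (10 * r)"
        using that eps by (auto simp: ball_subset_ball_iff dist_commute)
      then show "ball a \<epsilon> \<subseteq> \<Omega>" using sub by blast
    qed
    have estimate: "u a - u b \<le> 6 / \<alpha> * inverse r * dist a b *
        ((SUP z\<in>ball z0 (6 * r). u z) - (INF z\<in>ball z0 (6 * r). u z))"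
      if "a \<in> ball z0 r" "b \<in> ball z0 r" "dist a b \<ge> \<epsilon>" for a b
      by (rule dpp_lipschitz_estimate[OF coeffs eps dpp int bdd that])
    show "\<bar>u x - u y\<bar> \<le> 6 / \<alpha> * inverse r * dist x y *
        ((SUP z\<in>ball z0 (6 * r). u z) - (INF z\<in>ball z0 (6 * r). u z))"
      using estimate[of x y] estimate[of y x] xy by (simp add: dist_commute abs_le_iff)
  qed
qed

end
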